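(* (Direct part.) Let $I\subset\mathbb{R}$ be an open interval and let $f:I\to\mathbb{R}$ be a smooth function with $f\neq0$, $f'\neq0$ and $f f''+(f')^2\neq0$ at every point of $I$. Let $\eta\in\{1,-1\}$ and $C\in\mathbb{R}$, and set $$\varphi(u)=f'(u)\left(C+\eta\left(-\frac{1}{f'(u)}+\int\frac{du}{f(u)}\right)\right),$$ where $\int\frac{du}{f(u)}$ denotes an antiderivative of $1/f$ on $I$. Let $x_1$ be any antiderivative of $\varphi$ and $g$ any antiderivative of $\frac{\varphi^2-1}{2f'}$ on $I$. Then $c:\ \widetilde z(u)=x_1(u)\,e_1+f(u)\,\xi_1+g(u)\,\xi_2$, $u\in I$, is a spacelike curve in $\mathbb{E}^4_2$ and the rotational surface of parabolic type $$z(u,v)=x_1(u)\,e_1+f(u)\,\xi_1+(-v^2f(u)+g(u))\,\xi_2+\sqrt2\,v f(u)\,e_4,\quad u\in I,\ v\in\mathbb{R},$$ generated by $c$ is quasi-minimal. (Converse part.) Let $\mathcal{M}'''$ be a quasi-minimal rotational surface of parabolic type, generated by an arc-length parameterized spacelike curve $\widetilde z(u)=x_1(u)e_1+f(u)\xi_1+g(u)\xi_2$, $u\in J$, with $f\neq0$ and $f'\neq0$ on $J$. Then every $u_0\in J$ has an open interval $I\subset J$ containing it on which $f f''+(f')^2\neq0$, together with some $\eta\in\{1,-1\}$, $C\in\mathbb{R}$ and an antiderivative $\int\frac{du}{f(u)}$ of $1/f$ on $I$, such that, with $$\varphi(u)=f'(u)\left(C+\eta\left(-\frac{1}{f'(u)}+\int\frac{du}{f(u)}\right)\right),\quad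 u\in I,$$ one has $x_1'=\varphi$ and $g'=\frac{\varphi^2-1}{2f'}$ on $I$.
   Context: $\mathbb{E}^4_2$ is $\mathbb{R}^4$ with the indefinite inner product $\langle x,y\rangle=x_1y_1+x_2y_2-x_3y_3-x_4y_4$, with standard basis $e_1,e_2,e_3,e_4$. Put $\xi_1=\frac{e_2+e_3}{\sqrt2}$, $\xi_2=\frac{-e_2+e_3}{\sqrt2}$, so that $\langle\xi_1,\xi_1\rangle=\langle\xi_2,\xi_2\rangle=0$, $\langle\xi_1,\xi_2\rangle=-1$. A vector $v$ is spacelike if $\langle v,v\rangle>0$, timelike if $\langle v,v\rangle<0$, lightlike if $v\ne0$ and $\langle v,v\rangle=0$. A smooth curve is spacelike if its velocity is spacelike at each point. A surface is Lorentz if its induced metric has signature $(1,1)$; then its normal spaces also have signature $(1,1)$. For a Lorentz surface, the second fundamental form $\sigma(x,y)$ is the normal component of $\nabla'_x y$, where $\nabla'$ is the flat connection of $\mathbb{E}^4_2$ and $x,y$ are tangent vector fields. The mean curvature vector is $H=\frac12\operatorname{tr}\sigma$ (trace with respect to the induced metric), i.e. $H=\frac12(\sigma(X,X)-\sigma(Y,Y))$ for an orthonormal tangent frame with $\langle X,X\rangle=1$, $\langle Y,Y\rangle=-1$, $\langle X,Y\rangle=0$. The surface is quasi-minimal if $H$ is lightlike at each point, i.e. $H\neq0$ and $\langle H,H\rangle=0$ everywhere. Rotational surface of parabolic type: let $J\subset\mathbb{R}$ be an open interval and $\widetilde z(u)=x_1(u)e_1+f(u)\xi_1+g(u)\xi_2$,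 $u\in J$, a smooth spacelike curve parameterized by arc-length, i.e. $(x_1')^2-2f'g'=1$, with $f\ne0$. The rotational surface of parabolic type $\mathcal{M}'''$ generated by it is $z(u,v)=x_1(u)e_1+f(u)\xi_1+(-v^2f(u)+g(u))\xi_2+\sqrt2\,v f(u)e_4$, $u\in J$, $v\in\mathbb{R}$. It is a Lorentz surface with $\langle z_u,z_u\rangle=1$, $\langle z_u,z_v\rangle=0$, $\langle z_v,z_v\rangle=-2f^2$. Standing assumption: $f'\neq0$ on $J$. *)

theory Defs
  imports "HOL-Analysis.Analysis"
begin

section \<open>The pseudo-Euclidean space of dimension 4 and index 2\<close>

definition pinner :: "real^4 \<Rightarrow> real^4 \<Rightarrow> real" where
  "pinner x y = x$1 * y$1 + x$2 * y$2 - x$3 * y$3 - x$4 * y$4"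

definition spacelike :: "real^4 \<Rightarrow> bool" where
  "spacelike v \<longleftrightarrow> pinner v v > 0"

definition lightlike :: "real^4 \<Rightarrow> bool" where
  "lightlike v \<longleftrightarrow> v \<noteq> 0 \<and> pinner v v = 0"

abbreviation e1 :: "real^4" where "e1 \<equiv> axis 1 1"
abbreviation e2 :: "real^4" where "e2 \<equiv> axis 2 1"
abbreviation e3 :: "real^4" where "e3 \<equiv> axis 3 1"
abbreviation e4 :: "real^4" where "e4 \<equiv> axis 4 1"

definition xi1 :: "real^4" where "xi1 = (1 / sqrt 2) *\<^sub>R (e2 + e3)"
definition xi2 :: "real^4" where "xi2 = (1 / sqrt 2) *\<^sub>R (- e2 + e3)"


section \<open>Smooth maps, curves\<close>

text \<open>Smoothness in the sense of infinitely often differentiable, for an open set \<open>S\<close> (all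
  derivatives are taken in the ambient space): \<open>f\<close> is differentiable at every point of \<open>S\<close> and
  each directional derivative of \<open>f\<close> is again smooth. Being coinductive, the condition is
  required to all orders.\<close>

coinductive smooth_on ::
    "'a::real_normed_vector set \<Rightarrow> ('a \<Rightarrow> 'b::real_normed_vector) \<Rightarrow> bool"
  for S where
  smooth_onI: "\<lbrakk>\<And>x. x \<in> S \<Longrightarrow> f differentiable (at x);
     \<And>h. smooth_on S (\<lambda>x. frechet_derivative f (at x) h)\<rbrakk> \<Longrightarrow> smooth_on S f"

definition spacelike_curve :: "(real \<Rightarrow> real^4) \<Rightarrow> real set \<Rightarrow> bool" where
  "spacelike_curve c I \<longleftrightarrow>
     smooth_on I c \<and> (\<forall>u\<in>I. spacelike (vector_derivative c (at u)))"

definition arc_length_param :: "(real \<Rightarrow> real^4) \<Rightarrow> real set \<Rightarrow> bool" where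
  "arc_length_param c I \<longleftrightarrow>
     (\<forall>u\<in>I. pinner (vector_derivative c (at u)) (vector_derivative c (at u)) = 1)"


section \<open>Parametrized Lorentz surfaces\<close>

text \<open>A surface is given by a parametrization \<open>z\<close> on an open subset of the \<open>(u, v)\<close>-plane.
  Tangent vectors and tangent vector fields are represented by their components with respect to
  \<open>z\<^sub>u, z\<^sub>v\<close>, i.e. as elements of, and maps into, the parameter plane; \<open>push z X\<close> is the
  corresponding vector field along the surface in the ambient space.\<close>

type_synonym surface = "real \<times> real \<Rightarrow> real^4"
type_synonym vfield = "real \<times> real \<Rightarrow> real \<times> real"

definition push :: "surface \<Rightarrow> vfield \<Rightarrow> real \<times> real \<Rightarrow> real^4" where
  "push z X p = frechet_derivative z (at p) (X p)"

definition tangent_space :: "surface \<Rightarrow> real \<times> real \<Rightarrow> (real^4) set" where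
  "tangent_space z p = range (frechet_derivative z (at p))"

definition induced_metric :: "surface \<Rightarrow> vfield \<Rightarrow> vfield \<Rightarrow> real \<times> real \<Rightarrow> real" where
  "induced_metric z X Y p = pinner (push z X p) (push z Y p)"

definition orthonormal_frame_at :: "surface \<Rightarrow> vfield \<Rightarrow> vfield \<Rightarrow> real \<times> real \<Rightarrow> bool" where
  "orthonormal_frame_at z X Y p \<longleftrightarrow>
     induced_metric z X X p = 1 \<and> induced_metric z Y Y p = -1 \<and> induced_metric z X Y p = 0"

text \<open>The induced metric on the two-dimensional parameter plane has signature (1,1) at \<open>p\<close> iff it
  admits an orthonormal frame of that type at \<open>p\<close>; this forces the differential of \<open>z\<close> at
  \<open>p\<close> to be injective.\<close>

definition lorentz_surface :: "surface \<Rightarrow> (real \<times> real) set \<Rightarrow> bool" where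
  "lorentz_surface z D \<longleftrightarrow> smooth_on D z \<and> (\<forall>p\<in>D. \<exists>X Y. orthonormal_frame_at z X Y p)"

text \<open>Component in the normal space along the tangent space (unique where the induced metric is
  nondegenerate).\<close>

definition normal_part :: "surface \<Rightarrow> real \<times> real \<Rightarrow> real^4 \<Rightarrow> real^4" where
  "normal_part z p w =
     (THE n. (\<forall>t\<in>tangent_space z p. pinner n t = 0) \<and> w - n \<in> tangent_space z p)"

definition flat_connection :: "surface \<Rightarrow> vfield \<Rightarrow> vfield \<Rightarrow> real \<times> real \<Rightarrow> real^4" where
  "flat_connection z X Y p = frechet_derivative (push z Y) (at p) (X p)"

definition second_fundamental_form ::
    "surface \<Rightarrow> vfield \<Rightarrow> vfield \<Rightarrow> real \<times> real \<Rightarrow> real^4" where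
  "second_fundamental_form z X Y p = normal_part z p (flat_connection z X Y p)"

abbreviation coord_u :: vfield where "coord_u \<equiv> \<lambda>_. (1, 0)"
abbreviation coord_v :: vfield where "coord_v \<equiv> \<lambda>_. (0, 1)"

text \<open>Half the trace of the second fundamental form with respect to the induced metric, i.e.
  \<open>(\<Sum>i j. g\<^sup>i\<^sup>j \<sigma>(\<partial>\<^sub>i, \<partial>\<^sub>j)) / 2\<close> with the inverse of the 2 by 2 Gram matrix of
  \<open>\<partial>\<^sub>u, \<partial>\<^sub>v\<close> written out. The lemma \<open>mean_curvature_orthonormal_frame\<close> below is the
  expression in terms of orthonormal tangent frames.\<close>

definition mean_curvature :: "surface \<Rightarrow> real \<times> real \<Rightarrow> real^4" where
  "mean_curvature z p =
    (let E = induced_metric z coord_u coord_u p;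
         F = induced_metric z coord_u coord_v p;
         G = induced_metric z coord_v coord_v p;
         \<sigma> = second_fundamental_form z
     in (1 / 2) *\<^sub>R ((G / (E * G - F\<^sup>2)) *\<^sub>R \<sigma> coord_u coord_u p
          - (F / (E * G - F\<^sup>2)) *\<^sub>R (\<sigma> coord_u coord_v p + \<sigma> coord_v coord_u p)
          + (E / (E * G - F\<^sup>2)) *\<^sub>R \<sigma> coord_v coord_v p))"

definition quasi_minimal :: "surface \<Rightarrow> (real \<times> real) set \<Rightarrow> bool" where
  "quasi_minimal z D \<longleftrightarrow> lorentz_surface z D \<and> (\<forall>p\<in>D. lightlike (mean_curvature z p))"

lemma pinner_simps:
  "pinner (x + y) w = pinner x w + pinner y w"
  "pinner w (x + y) = pinner w x + pinner w y"
  "pinner (x - y) w = pinner x w - pinner y w"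
  "pinner w (x - y) = pinner w x - pinner w y"
  "pinner (a *\<^sub>R x) w = a * pinner x w"
  "pinner w (a *\<^sub>R x) = a * pinner w x"
  by (simp_all add: pinner_def algebra_simps)

lemma pinner_commute: "pinner x y = pinner y x"
  by (simp add: pinner_def algebra_simps)

lemma normal_part_eq:
  assumes T: "\<And>t. t \<in> tangent_space z p \<longleftrightarrow> (\<exists>r s. t = r *\<^sub>R A + s *\<^sub>R B)"
    and A: "pinner A A = 1" and B: "pinner B B = -1" and AB: "pinner A B = 0"
  shows "normal_part z p w = w - pinner w A *\<^sub>R A + pinner w B *\<^sub>R B"
  unfolding normal_part_def
proof (rule the_equality, intro conjI ballI)
  let ?n = "w - pinner w A *\<^sub>R A + pinner w B *\<^sub>R B"
  have BA: "pinner B A = 0" using AB by (simp add: pinner_commute)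
  show "pinner ?n t = 0" if "t \<in> tangent_space z p" for t
    using that A B AB BA by (auto simp: T pinner_simps)
  have "w - ?n = pinner w A *\<^sub>R A + (- pinner w B) *\<^sub>R B" by simp
  then show "w - ?n \<in> tangent_space z p" unfolding T by blast
  fix n assume n: "(\<forall>t\<in>tangent_space z p. pinner n t = 0) \<and> w - n \<in> tangent_space z p"
  have "A = 1 *\<^sub>R A + 0 *\<^sub>R B" "B = 0 *\<^sub>R A + 1 *\<^sub>R B" by simp_all
  then have "A \<in> tangent_space z p" "B \<in> tangent_space z p" unfolding T by blast+
  then have nA: "pinner n A = 0" and nB: "pinner n B = 0" using n by auto
  from n obtain r s where "w - n = r *\<^sub>R A + s *\<^sub>R B" unfolding T by blast
  then have w: "w = n + r *\<^sub>R A + s *\<^sub>R B" by (simp add: algebra_simps)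
  have "pinner w A = r" "pinner w B = - s"
    unfolding w by (simp_all add: pinner_simps nA nB A B AB BA)
  then show "n = ?n" using w by simp
qed

lemma inverse_gram_orthonormal:
  fixes a b c d E F G :: real
  assumes h1: "a\<^sup>2 * E + 2 * a * b * F + b\<^sup>2 * G = 1"
    and h2: "c\<^sup>2 * E + 2 * c * d * F + d\<^sup>2 * G = -1"
    and h3: "a * c * E + (a * d + b * c) * F + b * d * G = 0"
  shows "a * d - b * c \<noteq> 0"
    and "G / (E * G - F\<^sup>2) = a\<^sup>2 - c\<^sup>2"
    and "F / (E * G - F\<^sup>2) = - (a * b - c * d)"
    and "E / (E * G - F\<^sup>2) = b\<^sup>2 - d\<^sup>2"
proof -
  have det: "(a * d - b * c)\<^sup>2 * (E * G - F\<^sup>2) = -1"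
  proof -
    have "(a * d - b * c)\<^sup>2 * (E * G - F\<^sup>2)
        = (a\<^sup>2 * E + 2 * a * b * F + b\<^sup>2 * G) * (c\<^sup>2 * E + 2 * c * d * F + d\<^sup>2 * G)
          - (a * c * E + (a * d + b * c) * F + b * d * G)\<^sup>2" by algebra
    then show ?thesis using h1 h2 h3 by simp
  qed
  then show D: "a * d - b * c \<noteq> 0" by auto
  have W: "E * G - F\<^sup>2 \<noteq> 0" using det by auto
  have D2: "(a * d - b * c)\<^sup>2 \<noteq> 0" using D by simp
  have "(a * d - b * c)\<^sup>2 * G = c\<^sup>2 - a\<^sup>2" using h1 h2 h3 by algebra
  then have "(a * d - b * c)\<^sup>2 * G = (a * d - b * c)\<^sup>2 * ((a\<^sup>2 - c\<^sup>2) * (E * G - F\<^sup>2))"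
    using det by algebra
  then have "G = (a\<^sup>2 - c\<^sup>2) * (E * G - F\<^sup>2)" using D2 mult_left_cancel by blast
  then show "G / (E * G - F\<^sup>2) = a\<^sup>2 - c\<^sup>2" using W by (metis nonzero_mult_div_cancel_right)
  have "(a * d - b * c)\<^sup>2 * F = a * b - c * d" using h1 h2 h3 by algebra
  then have "(a * d - b * c)\<^sup>2 * F = (a * d - b * c)\<^sup>2 * (- (a * b - c * d) * (E * G - F\<^sup>2))"
    using det by algebra
  then have "F = - (a * b - c * d) * (E * G - F\<^sup>2)" using D2 mult_left_cancel by blast
  then show "F / (E * G - F\<^sup>2) = - (a * b - c * d)"
    using W by (metis nonzero_mult_div_cancel_right)
  have "(a * d - b * c)\<^sup>2 * E = d\<^sup>2 - b\<^sup>2" using h1 h2 h3 by algebra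
  then have "(a * d - b * c)\<^sup>2 * E = (a * d - b * c)\<^sup>2 * ((b\<^sup>2 - d\<^sup>2) * (E * G - F\<^sup>2))"
    using det by algebra
  then have "E = (b\<^sup>2 - d\<^sup>2) * (E * G - F\<^sup>2)" using D2 mult_left_cancel by blast
  then show "E / (E * G - F\<^sup>2) = b\<^sup>2 - d\<^sup>2" using W by (metis nonzero_mult_div_cancel_right)
qed

lemma mean_curvature_orthonormal_frame:
  assumes D: "open D" "p \<in> D" and z: "smooth_on D z"
    and X: "X differentiable (at p)" and Y: "Y differentiable (at p)"
    and fr: "orthonormal_frame_at z X Y p"
  shows "mean_curvature z p =
    (1 / 2) *\<^sub>R (second_fundamental_form z X X p - second_fundamental_form z Y Y p)"
proof -
  define U where "U = push z coord_u"
  define V where "V = push z coord_v"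
  have zd: "z differentiable (at q)" if "q \<in> D" for q
    using z that by (cases rule: smooth_on.cases) auto
  have push_eq: "push z Z q = fst (Z q) *\<^sub>R U q + snd (Z q) *\<^sub>R V q" if "q \<in> D" for Z q
  proof -
    have lin: "linear (frechet_derivative z (at q))"
      using zd[OF that] by (rule linear_frechet_derivative)
    have "Z q = fst (Z q) *\<^sub>R (1, 0) + snd (Z q) *\<^sub>R (0, 1)"
      by (simp add: prod_eq_iff)
    then show ?thesis
      unfolding push_def U_def V_def
      by (metis linear_add[OF lin] linear_scale[OF lin])
  qed
  have UVd: "U differentiable (at p)" "V differentiable (at p)"
  proof -
    have "smooth_on D (\<lambda>q. frechet_derivative z (at q) h)" for h
      using z by (cases rule: smooth_on.cases) auto
    then have "(\<lambda>q. frechet_derivative z (at q) h) differentiable (at p)" for h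
      using D(2) by (metis smooth_on.cases)
    then show "U differentiable (at p)" "V differentiable (at p)"
      unfolding U_def V_def push_def by blast+
  qed
  define U' where "U' = frechet_derivative U (at p)"
  define V' where "V' = frechet_derivative V (at p)"
  have U': "(U has_derivative U') (at p)" and V': "(V has_derivative V') (at p)"
    using UVd by (simp_all add: U'_def V'_def frechet_derivative_works)
  have linU: "linear U'" and linV: "linear V'"
    using U' V' has_derivative_linear by auto
  have flat: "\<exists>r s. flat_connection z Z Z p =
      fst (Z p) *\<^sub>R U' (Z p) + snd (Z p) *\<^sub>R V' (Z p) + (r *\<^sub>R U p + s *\<^sub>R V p)"
    if Z: "Z differentiable (at p)" for Z
  proof -
    define Z' where "Z' = frechet_derivative Z (at p)"
    have Z': "(Z has_derivative Z') (at p)"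
      using Z by (simp add: Z'_def frechet_derivative_works)
    have "((\<lambda>q. fst (Z q) *\<^sub>R U q + snd (Z q) *\<^sub>R V q) has_derivative
       (\<lambda>h. (fst (Z p) *\<^sub>R U' h + fst (Z' h) *\<^sub>R U p) + (snd (Z p) *\<^sub>R V' h + snd (Z' h) *\<^sub>R V p)))
         (at p)"
      by (intro has_derivative_add has_derivative_scaleR has_derivative_fst has_derivative_snd
          Z' U' V')
    then have "(push z Z has_derivative
       (\<lambda>h. (fst (Z p) *\<^sub>R U' h + fst (Z' h) *\<^sub>R U p) + (snd (Z p) *\<^sub>R V' h + snd (Z' h) *\<^sub>R V p)))
         (at p)"
      by (rule has_derivative_transform_within_open[OF _ D]) (simp add: push_eq)
    then have "frechet_derivative (push z Z) (at p) =
       (\<lambda>h. (fst (Z p) *\<^sub>R U' h + fst (Z' h) *\<^sub>R U p) + (snd (Z p) *\<^sub>R V' h + snd (Z' h) *\<^sub>R V p))"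
      by (rule frechet_derivative_at[symmetric])
    then have "flat_connection z Z Z p =
      fst (Z p) *\<^sub>R U' (Z p) + snd (Z p) *\<^sub>R V' (Z p)
       + (fst (Z' (Z p)) *\<^sub>R U p + snd (Z' (Z p)) *\<^sub>R V p)"
      by (simp add: flat_connection_def algebra_simps)
    then show ?thesis by blast
  qed
  obtain a b where Xp: "X p = (a, b)" by fastforce
  obtain c d where Yp: "Y p = (c, d)" by fastforce
  define A where "A = push z X p"
  define B where "B = push z Y p"
  have A: "A = a *\<^sub>R U p + b *\<^sub>R V p" and B: "B = c *\<^sub>R U p + d *\<^sub>R V p"
    using push_eq[OF D(2)] by (simp_all add: A_def B_def Xp Yp)
  have orth: "pinner A A = 1" "pinner B B = -1" "pinner A B = 0"
    using fr by (simp_all add: orthonormal_frame_at_def induced_metric_def A_def B_def)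
  define E where "E = pinner (U p) (U p)"
  define F where "F = pinner (U p) (V p)"
  define G where "G = pinner (V p) (V p)"
  have F': "pinner (V p) (U p) = F" by (simp add: F_def pinner_commute)
  have gram: "a\<^sup>2 * E + 2 * a * b * F + b\<^sup>2 * G = 1"
    "c\<^sup>2 * E + 2 * c * d * F + d\<^sup>2 * G = -1"
    "a * c * E + (a * d + b * c) * F + b * d * G = 0"
    using orth unfolding A B pinner_simps F' E_def[symmetric] F_def[symmetric] G_def[symmetric]
    by (simp_all add: algebra_simps power2_eq_square)
  note inv = inverse_gram_orthonormal[OF gram]
  have TUV: "t \<in> tangent_space z p \<longleftrightarrow> (\<exists>r s. t = r *\<^sub>R U p + s *\<^sub>R V p)" for t
  proof -
    have "frechet_derivative z (at p) h = fst h *\<^sub>R U p + snd h *\<^sub>R V p" for h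
      using push_eq[OF D(2), of "\<lambda>_. h"] by (simp add: push_def)
    then show ?thesis
      unfolding tangent_space_def by (auto simp: image_iff)
  qed
  define \<Delta> where "\<Delta> = a * d - b * c"
  have \<Delta>: "\<Delta> \<noteq> 0" using inv(1) by (simp add: \<Delta>_def)
  have UAB: "U p = (d / \<Delta>) *\<^sub>R A + (- b / \<Delta>) *\<^sub>R B"
  proof -
    have "(d / \<Delta>) *\<^sub>R A + (- b / \<Delta>) *\<^sub>R B
        = ((d * a - b * c) / \<Delta>) *\<^sub>R U p + ((d * b - b * d) / \<Delta>) *\<^sub>R V p"
      unfolding A B by (simp add: algebra_simps diff_divide_distrib)
    then show ?thesis using \<Delta> by (simp add: \<Delta>_def algebra_simps)
  qed
  have VAB: "V p = (- c / \<Delta>) *\<^sub>R A + (a / \<Delta>) *\<^sub>R B"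
  proof -
    have "(- c / \<Delta>) *\<^sub>R A + (a / \<Delta>) *\<^sub>R B
        = ((a * c - c * a) / \<Delta>) *\<^sub>R U p + ((a * d - c * b) / \<Delta>) *\<^sub>R V p"
      unfolding A B by (simp add: algebra_simps diff_divide_distrib)
    then show ?thesis using \<Delta> by (simp add: \<Delta>_def algebra_simps)
  qed
  have TAB: "t \<in> tangent_space z p \<longleftrightarrow> (\<exists>r s. t = r *\<^sub>R A + s *\<^sub>R B)" for t
  proof
    assume "t \<in> tangent_space z p"
    then obtain r s where t: "t = r *\<^sub>R U p + s *\<^sub>R V p" unfolding TUV by blast
    have "t = (r * (d / \<Delta>) + s * (- c / \<Delta>)) *\<^sub>R A + (r * (- b / \<Delta>) + s * (a / \<Delta>)) *\<^sub>R B"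
      unfolding t UAB VAB by (simp add: algebra_simps)
    then show "\<exists>r s. t = r *\<^sub>R A + s *\<^sub>R B" by blast
  next
    assume "\<exists>r s. t = r *\<^sub>R A + s *\<^sub>R B"
    then obtain r s where t: "t = r *\<^sub>R A + s *\<^sub>R B" by blast
    have "t = (r * a + s * c) *\<^sub>R U p + (r * b + s * d) *\<^sub>R V p"
      unfolding t A B by (simp add: algebra_simps)
    then show "t \<in> tangent_space z p" unfolding TUV by blast
  qed
  define N where "N = normal_part z p"
  have N: "N w = w - pinner w A *\<^sub>R A + pinner w B *\<^sub>R B" for w
    unfolding N_def by (rule normal_part_eq[OF TAB orth])
  have N_add: "N (x + y) = N x + N y" and N_scale: "N (r *\<^sub>R x) = r *\<^sub>R N x" for x y r
    by (simp_all add: N pinner_simps algebra_simps)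
  have "N A = 0" "N B = 0"
    using orth by (simp_all add: N pinner_commute[of B A])
  then have NUV: "N (U p) = 0" "N (V p) = 0"
    unfolding UAB VAB N_add N_scale by simp_all
  have \<sigma>: "second_fundamental_form z Z Z p
      = (fst (Z p))\<^sup>2 *\<^sub>R N (U' (1, 0))
        + (fst (Z p) * snd (Z p)) *\<^sub>R (N (U' (0, 1)) + N (V' (1, 0)))
        + (snd (Z p))\<^sup>2 *\<^sub>R N (V' (0, 1))"
    if Z: "Z differentiable (at p)" for Z
  proof -
    have "Z p = fst (Z p) *\<^sub>R (1, 0) + snd (Z p) *\<^sub>R (0, 1)"
      by (simp add: prod_eq_iff)
    then have U'Z: "U' (Z p) = fst (Z p) *\<^sub>R U' (1, 0) + snd (Z p) *\<^sub>R U' (0, 1)"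
      and V'Z: "V' (Z p) = fst (Z p) *\<^sub>R V' (1, 0) + snd (Z p) *\<^sub>R V' (0, 1)"
      by (metis linear_add[OF linU] linear_scale[OF linU])
        (metis \<open>Z p = _\<close> linear_add[OF linV] linear_scale[OF linV])
    obtain r s where "flat_connection z Z Z p =
      fst (Z p) *\<^sub>R U' (Z p) + snd (Z p) *\<^sub>R V' (Z p) + (r *\<^sub>R U p + s *\<^sub>R V p)"
      using flat[OF Z] by blast
    then have "second_fundamental_form z Z Z p
      = fst (Z p) *\<^sub>R N (U' (Z p)) + snd (Z p) *\<^sub>R N (V' (Z p))"
      by (simp add: second_fundamental_form_def N_def[symmetric] N_add N_scale NUV)
    then show ?thesis
      unfolding U'Z V'Z N_add N_scale by (simp add: algebra_simps power2_eq_square)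
  qed
  have \<sigma>_coord: "second_fundamental_form z coord_u coord_u p = N (U' (1, 0))"
    "second_fundamental_form z coord_u coord_v p = N (V' (1, 0))"
    "second_fundamental_form z coord_v coord_u p = N (U' (0, 1))"
    "second_fundamental_form z coord_v coord_v p = N (V' (0, 1))"
    by (simp_all add: second_fundamental_form_def flat_connection_def N_def U'_def V'_def
        U_def V_def)
  have "mean_curvature z p = (1 / 2) *\<^sub>R ((a\<^sup>2 - c\<^sup>2) *\<^sub>R N (U' (1, 0))
      + (a * b - c * d) *\<^sub>R (N (V' (1, 0)) + N (U' (0, 1))) + (b\<^sup>2 - d\<^sup>2) *\<^sub>R N (V' (0, 1)))"
    unfolding mean_curvature_def Let_def \<sigma>_coord induced_metric_def U_def[symmetric]
      V_def[symmetric] E_def[symmetric] F_def[symmetric] G_def[symmetric] inv(2-4)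
    by (simp flip: scaleR_minus_left)
  also have "\<dots> = (1 / 2) *\<^sub>R (second_fundamental_form z X X p - second_fundamental_form z Y Y p)"
    unfolding \<sigma>[OF X] \<sigma>[OF Y] Xp Yp by (simp add: algebra_simps)
  finally show ?thesis .
qed

section \<open>Rotational surfaces of parabolic type\<close>

definition profile_curve ::
    "(real \<Rightarrow> real) \<Rightarrow> (real \<Rightarrow> real) \<Rightarrow> (real \<Rightarrow> real) \<Rightarrow> real \<Rightarrow> real^4" where
  "profile_curve x1 f g u = x1 u *\<^sub>R e1 + f u *\<^sub>R xi1 + g u *\<^sub>R xi2"

definition parabolic_rotational_surface ::
    "(real \<Rightarrow> real) \<Rightarrow> (real \<Rightarrow> real) \<Rightarrow> (real \<Rightarrow> real) \<Rightarrow> surface" where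
  "parabolic_rotational_surface x1 f g = (\<lambda>(u, v).
     x1 u *\<^sub>R e1 + f u *\<^sub>R xi1 + (- v\<^sup>2 * f u + g u) *\<^sub>R xi2 + (sqrt 2 * v * f u) *\<^sub>R e4)"

definition open_interval :: "real set \<Rightarrow> bool" where
  "open_interval I \<longleftrightarrow> open I \<and> is_interval I \<and> I \<noteq> {}"

definition antiderivative_on :: "real set \<Rightarrow> (real \<Rightarrow> real) \<Rightarrow> (real \<Rightarrow> real) \<Rightarrow> bool" where
  "antiderivative_on I F h \<longleftrightarrow> (\<forall>u\<in>I. (F has_real_derivative h u) (at u))"

text \<open>\<open>F\<close> plays the role of the antiderivative of \<open>1 / f\<close>.\<close>

definition phi ::
    "(real \<Rightarrow> real) \<Rightarrow> real \<Rightarrow> real \<Rightarrow> (real \<Rightarrow> real) \<Rightarrow> real \<Rightarrow> real" where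
  "phi f \<eta> C F u = deriv f u * (C + \<eta> * (- 1 / deriv f u + F u))"

end

theory Submission
  imports Defs
begin

text \<open>Let \<open>\<phi> = x\<^sub>1'\<close>. Since \<open>\<langle>z\<^sub>u, z\<^sub>u\<rangle> = 1\<close>, \<open>\<langle>z\<^sub>u, z\<^sub>v\<rangle> = 0\<close> and \<open>z\<^sub>v\<^sub>v = - 2 f \<xi>\<^sub>2\<close>,
  the mean curvature vector satisfies \<open>2 H = z\<^sub>u\<^sub>u + \<xi>\<^sub>2 / f + (f' / f) z\<^sub>u\<close>. Eliminating \<open>g\<close> by
  \<open>\<phi>\<^sup>2 - 2 f' g' = 1\<close> gives
  \<open>\<langle>2 H, 2 H\<rangle> = (\<phi>' - f'' \<phi> / f')\<^sup>2 - (f'' / f' + f' / f)\<^sup>2\<close>, and where this vanishes,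
  \<open>H = 0\<close> exactly if \<open>f f'' + f'\<^sup>2 = 0\<close>. Dividing
  \<open>\<phi>' - f'' \<phi> / f' = \<eta> (f'' / f' + f' / f)\<close> by \<open>f'\<close> yields
  \<open>(\<phi> / f')' = \<eta> (- 1 / f' + \<integral> 1 / f)'\<close>, which is the formula for \<open>\<phi>\<close>.\<close>

section \<open>Smooth maps\<close>

lemma smooth_on_differentiable: "smooth_on S f \<Longrightarrow> x \<in> S \<Longrightarrow> f differentiable (at x)"
  by (erule smooth_on.cases) simp

lemma smooth_on_frechet_derivative:
  "smooth_on S f \<Longrightarrow> smooth_on S (\<lambda>x. frechet_derivative f (at x) h)"
  by (erule smooth_on.cases) simp

lemma smooth_on_has_derivative:
  assumes "smooth_on S f" "x \<in> S"
  shows "(f has_derivative frechet_derivative f (at x)) (at x)"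
  using assms smooth_on_differentiable frechet_derivative_works by blast

text \<open>As \<open>S\<close> is open, functions that agree on \<open>S\<close> have the same
  derivatives there, so agreement on \<open>S\<close> with a member of \<open>P\<close> passes to
  directional derivatives and is a coinduction invariant. Choosing \<open>P\<close> as a class of
  explicit functions avoids \<open>frechet_derivative\<close> outside \<open>S\<close>, where
  nothing is known about it.\<close>

lemma smooth_on_coinduct_cong:
  assumes "open S" "P k" "\<And>x. x \<in> S \<Longrightarrow> f x = k x"
    and step: "\<And>k. P k \<Longrightarrow>
      \<exists>k'. (\<forall>x\<in>S. (k has_derivative k' x) (at x)) \<and> (\<forall>h. P (\<lambda>x. k' x h))"
  shows "smooth_on S f"
proof -
  have "\<exists>k. P k \<and> (\<forall>x\<in>S. f x = k x)" using assms by blast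
  then show ?thesis
  proof (coinduction arbitrary: f rule: smooth_on.coinduct)
    case smooth_on
    then obtain k where k: "P k" "\<And>x. x \<in> S \<Longrightarrow> f x = k x" by blast
    obtain k' where k': "\<And>x. x \<in> S \<Longrightarrow> (k has_derivative k' x) (at x)" "\<And>h. P (\<lambda>x. k' x h)"
      using step[OF k(1)] by blast
    have D: "(f has_derivative k' x) (at x)" if "x \<in> S" for x
      by (rule has_derivative_transform_within_open[OF k'(1)[OF that] \<open>open S\<close> that])
        (simp add: k)
    have "frechet_derivative f (at x) = k' x" if "x \<in> S" for x
      using frechet_derivative_at[OF D[OF that]] by simp
    then show ?case
      using D k'(2) by (fastforce simp: differentiable_def)
  qed
qed

lemma smooth_on_cong:
  assumes "open S" "smooth_on S g" "\<And>x. x \<in> S \<Longrightarrow> f x = g x"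
  shows "smooth_on S f"
proof (rule smooth_on_coinduct_cong[where P = "smooth_on S", OF assms])
  fix k assume "smooth_on S k"
  then show "\<exists>k'. (\<forall>x\<in>S. (k has_derivative k' x) (at x)) \<and> (\<forall>h. smooth_on S (\<lambda>x. k' x h))"
    by (intro exI[of _ "\<lambda>x. frechet_derivative k (at x)"])
      (auto intro: smooth_on_has_derivative smooth_on_frechet_derivative)
qed

text \<open>The inner derivative is the constant \<open>L\<close>, so the derivative in direction
  \<open>h\<close> is that of \<open>f\<close> in direction \<open>L h\<close>, again composed with
  \<open>L\<close>. The class of such composites is thus closed under differentiation without any
  products.\<close>

lemma smooth_on_compose_linear:
  assumes "open S" "smooth_on T f" "bounded_linear L" "L ` S \<subseteq> T"
  shows "smooth_on S (\<lambda>x. f (L x))"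
proof (rule smooth_on_coinduct_cong[where P = "\<lambda>k. \<exists>f. smooth_on T f \<and> k = (\<lambda>x. f (L x))"])
  fix k assume "\<exists>f. smooth_on T f \<and> k = (\<lambda>x. f (L x))"
  then obtain f where f: "smooth_on T f" "k = (\<lambda>x. f (L x))" by blast
  have "(k has_derivative (\<lambda>h. frechet_derivative f (at (L x)) (L h))) (at x)" if "x \<in> S" for x
    unfolding f(2)
    by (rule has_derivative_compose[OF bounded_linear_imp_has_derivative[OF assms(3)]
          smooth_on_has_derivative[OF f(1)]])
      (use that assms(4) in auto)
  then show "\<exists>k'. (\<forall>x\<in>S. (k has_derivative k' x) (at x)) \<and>
      (\<forall>h. \<exists>f. smooth_on T f \<and> (\<lambda>x. k' x h) = (\<lambda>x. f (L x)))"
    by (intro exI[of _ "\<lambda>x h. frechet_derivative f (at (L x)) (L h)"])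
      (auto intro: smooth_on_frechet_derivative[OF f(1)])
qed (use assms in auto)

lemma smooth_on_linear_compose:
  assumes "open S" "smooth_on S f" "bounded_linear L"
  shows "smooth_on S (\<lambda>x. L (f x))"
proof (rule smooth_on_coinduct_cong[where P = "\<lambda>k. \<exists>f. smooth_on S f \<and> k = (\<lambda>x. L (f x))"])
  fix k assume "\<exists>f. smooth_on S f \<and> k = (\<lambda>x. L (f x))"
  then obtain f where f: "smooth_on S f" "k = (\<lambda>x. L (f x))" by blast
  have "(k has_derivative (\<lambda>h. L (frechet_derivative f (at x) h))) (at x)" if "x \<in> S" for x
    unfolding f(2)
    by (rule bounded_linear.has_derivative[OF assms(3) smooth_on_has_derivative[OF f(1) that]])
  then show "\<exists>k'. (\<forall>x\<in>S. (k has_derivative k' x) (at x)) \<and>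
      (\<forall>h. \<exists>f. smooth_on S f \<and> (\<lambda>x. k' x h) = (\<lambda>x. L (f x)))"
    by (intro exI[of _ "\<lambda>x h. L (frechet_derivative f (at x) h)"])
      (auto intro: smooth_on_frechet_derivative[OF f(1)])
qed (use assms in auto)

lemma smooth_on_add:
  assumes "open S" "smooth_on S f" "smooth_on S g"
  shows "smooth_on S (\<lambda>x. f x + g x)"
proof (rule smooth_on_coinduct_cong[where P = "\<lambda>k. \<exists>f g. smooth_on S f \<and> smooth_on S g \<and>
      k = (\<lambda>x. f x + g x)"])
  fix k assume "\<exists>f g. smooth_on S f \<and> smooth_on S g \<and> k = (\<lambda>x. f x + g x)"
  then obtain f g where fg: "smooth_on S f" "smooth_on S g" "k = (\<lambda>x. f x + g x)" by blast
  have "(k has_derivative (\<lambda>h. frechet_derivative f (at x) h + frechet_derivative g (at x) h))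
      (at x)" if "x \<in> S" for x
    unfolding fg(3) by (intro has_derivative_add smooth_on_has_derivative[OF fg(1) that]
        smooth_on_has_derivative[OF fg(2) that])
  then show "\<exists>k'. (\<forall>x\<in>S. (k has_derivative k' x) (at x)) \<and>
      (\<forall>h. \<exists>f g. smooth_on S f \<and> smooth_on S g \<and> (\<lambda>x. k' x h) = (\<lambda>x. f x + g x))"
    by (intro exI[of _ "\<lambda>x h. frechet_derivative f (at x) h + frechet_derivative g (at x) h"])
      (use smooth_on_frechet_derivative fg in blast)
qed (use assms in auto)

lemma smooth_on_const: "smooth_on S (\<lambda>x. c)"
proof -
  have "\<exists>c. f = (\<lambda>_. c) \<Longrightarrow> smooth_on S f" for f :: "'a \<Rightarrow> 'b"
    by (coinduction arbitrary: f rule: smooth_on.coinduct) auto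
  then show ?thesis by blast
qed

lemma smooth_on_bounded_linear: "bounded_linear L \<Longrightarrow> smooth_on S L"
  by (rule smooth_on.intros)
    (simp_all add: frechet_derivative_at[OF bounded_linear_imp_has_derivative, symmetric]
      smooth_on_const bounded_linear_imp_differentiable)

text \<open>The derivative of a product is a sum of products, and that of a reciprocal a product
  involving the same reciprocal. The coinductive proof that products and reciprocals are smooth
  therefore runs over the whole algebra generated by the smooth functions.\<close>

inductive smooth_algebra :: "'a::real_normed_vector set \<Rightarrow> ('a \<Rightarrow> real) \<Rightarrow> bool" for S where
  base: "smooth_on S f \<Longrightarrow> smooth_algebra S f"
| add: "smooth_algebra S f \<Longrightarrow> smooth_algebra S g \<Longrightarrow> smooth_algebra S (\<lambda>x. f x + g x)"
| mult: "smooth_algebra S f \<Longrightarrow> smooth_algebra S g \<Longrightarrow> smooth_algebra S (\<lambda>x. f x * g x)"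
| inverse: "smooth_algebra S f \<Longrightarrow> (\<And>x. x \<in> S \<Longrightarrow> f x \<noteq> 0) \<Longrightarrow>
    smooth_algebra S (\<lambda>x. inverse (f x))"

lemma smooth_algebra_derivative:
  assumes "smooth_algebra S k"
  shows "\<exists>k'. (\<forall>x\<in>S. (k has_derivative k' x) (at x)) \<and> (\<forall>h. smooth_algebra S (\<lambda>x. k' x h))"
  using assms
proof induction
  case (base f)
  then show ?case
    by (intro exI[of _ "\<lambda>x. frechet_derivative f (at x)"])
      (auto intro: smooth_on_has_derivative smooth_on_frechet_derivative smooth_algebra.base)
next
  case (add f g)
  then obtain f' g' where
    "\<forall>x\<in>S. (f has_derivative f' x) (at x)" "\<forall>h. smooth_algebra S (\<lambda>x. f' x h)"
    "\<forall>x\<in>S. (g has_derivative g' x) (at x)" "\<forall>h. smooth_algebra S (\<lambda>x. g' x h)" by blast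
  then show ?case
    by (intro exI[of _ "\<lambda>x h. f' x h + g' x h"])
      (auto intro!: has_derivative_add smooth_algebra.add)
next
  case (mult f g)
  then obtain f' g' where
    "\<forall>x\<in>S. (f has_derivative f' x) (at x)" "\<forall>h. smooth_algebra S (\<lambda>x. f' x h)"
    "\<forall>x\<in>S. (g has_derivative g' x) (at x)" "\<forall>h. smooth_algebra S (\<lambda>x. g' x h)" by blast
  with mult.hyps show ?case
    by (intro exI[of _ "\<lambda>x h. f x * g' x h + f' x h * g x"])
      (auto intro!: has_derivative_mult smooth_algebra.add smooth_algebra.mult)
next
  case (inverse f)
  then obtain f' where
    f': "\<forall>x\<in>S. (f has_derivative f' x) (at x)" "\<forall>h. smooth_algebra S (\<lambda>x. f' x h)" by blast
  \<comment> \<open>Negation is not a generator of the algebra, so the sign enters as a constant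
    factor.\<close>
  have "smooth_algebra S (\<lambda>x. (- 1) * (inverse (f x) * f' x h * inverse (f x)))" for h
    by (intro smooth_algebra.mult smooth_algebra.base[OF smooth_on_const] smooth_algebra.inverse
        inverse f'(2)[rule_format])
  with f'(1) inverse.hyps show ?case
    by (intro exI[of _ "\<lambda>x h. - (inverse (f x) * f' x h * inverse (f x))"])
      (auto intro!: has_derivative_inverse)
qed

text \<open>The algebra is closed under directional derivatives, hence is itself a coinduction
  invariant.\<close>

lemma smooth_algebra_imp_smooth_on:
  assumes "open S" "smooth_algebra S f"
  shows "smooth_on S f"
  by (rule smooth_on_coinduct_cong[where P = "smooth_algebra S", OF assms refl])
    (rule smooth_algebra_derivative)

lemma smooth_on_mult:
  fixes f g :: "'a::real_normed_vector \<Rightarrow> real"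
  assumes "open S" "smooth_on S f" "smooth_on S g"
  shows "smooth_on S (\<lambda>x. f x * g x)"
  by (rule smooth_algebra_imp_smooth_on[OF assms(1)
        smooth_algebra.mult[OF assms(2,3)[THEN smooth_algebra.base]]])

lemma smooth_on_inverse:
  fixes f :: "'a::real_normed_vector \<Rightarrow> real"
  assumes "open S" "smooth_on S f" "\<And>x. x \<in> S \<Longrightarrow> f x \<noteq> 0"
  shows "smooth_on S (\<lambda>x. inverse (f x))"
  by (rule smooth_algebra_imp_smooth_on[OF assms(1)
        smooth_algebra.inverse[OF smooth_algebra.base[OF assms(2)] assms(3)]])

lemma smooth_on_minus:
  assumes "open S" "smooth_on S f"
  shows "smooth_on S (\<lambda>x. - f x)"
  by (intro smooth_on_linear_compose[OF assms] bounded_linear_minus bounded_linear_ident)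

lemma smooth_on_diff:
  assumes "open S" "smooth_on S f" "smooth_on S g"
  shows "smooth_on S (\<lambda>x. f x - g x)"
  using smooth_on_add[OF assms(1,2) smooth_on_minus[OF assms(1,3)]] by simp

lemma smooth_on_divide:
  fixes f g :: "'a::real_normed_vector \<Rightarrow> real"
  assumes "open S" "smooth_on S f" "smooth_on S g" "\<And>x. x \<in> S \<Longrightarrow> g x \<noteq> 0"
  shows "smooth_on S (\<lambda>x. f x / g x)"
  using smooth_on_mult[OF assms(1,2) smooth_on_inverse[OF assms(1,3)]] assms(4)
  by (simp add: divide_inverse)

lemma smooth_on_power2:
  fixes f :: "'a::real_normed_vector \<Rightarrow> real"
  assumes "open S" "smooth_on S f"
  shows "smooth_on S (\<lambda>x. (f x)\<^sup>2)"
  using smooth_on_mult[OF assms assms(2)] by (simp add: power2_eq_square)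

section \<open>Smooth functions of one real variable\<close>

lemma smooth_on_DERIV:
  fixes f :: "real \<Rightarrow> real"
  assumes "smooth_on S f" "x \<in> S"
  shows "(f has_real_derivative deriv f x) (at x)"
  using smooth_on_differentiable[OF assms]
  by (simp add: DERIV_deriv_iff_real_differentiable)

text \<open>On \<open>S\<close>, \<open>deriv f\<close> is the directional derivative in direction
  \<open>1\<close>, which is smooth by definition.\<close>

lemma smooth_on_deriv:
  fixes f :: "real \<Rightarrow> real"
  assumes "open S" "smooth_on S f"
  shows "smooth_on S (deriv f)"
proof (rule smooth_on_cong[OF assms(1) smooth_on_frechet_derivative[OF assms(2)]])
  fix x assume "x \<in> S"
  then have "(f has_derivative (*) (deriv f x)) (at x)"
    using smooth_on_DERIV[OF assms(2)] by (simp add: has_field_derivative_def)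
  then show "deriv f x = frechet_derivative f (at x) 1"
    by (simp add: frechet_derivative_at[symmetric])
qed

text \<open>Only the first derivative needs a computation: in direction \<open>v\<close> it is
  \<open>h x * v\<close>, a product of smooth functions.\<close>

lemma smooth_on_antiderivative:
  assumes "open S" "smooth_on S h" "antiderivative_on S F h"
  shows "smooth_on S F"
proof (rule smooth_on.intros)
  have D: "(F has_derivative (*) (h x)) (at x)" if "x \<in> S" for x
    using assms(3) that by (simp add: antiderivative_on_def has_field_derivative_def)
  then show "F differentiable (at x)" if "x \<in> S" for x
    using that differentiable_def by blast
  show "smooth_on S (\<lambda>x. frechet_derivative F (at x) v)" for v
    by (rule smooth_on_cong[OF assms(1) smooth_on_mult[OF assms(1,2) smooth_on_const[of S v]]])
      (simp add: frechet_derivative_at[OF D, symmetric])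
qed

section \<open>Parabolic rotational surfaces\<close>

text \<open>The surface, its derivatives and its mean curvature vector are all written in this form,
  so that vector identities become identities between four coefficients.\<close>

definition xi_vec :: "real \<Rightarrow> real \<Rightarrow> real \<Rightarrow> real \<Rightarrow> real^4" where
  "xi_vec a b c d = a *\<^sub>R e1 + b *\<^sub>R xi1 + c *\<^sub>R xi2 + d *\<^sub>R e4"

lemma pinner_xi_vec:
  "pinner (xi_vec a b c d) (xi_vec a' b' c' d') = a * a' - b * c' - c * b' - d * d'"
proof -
  have basis: "pinner e1 e1 = 1" "pinner e1 xi1 = 0" "pinner e1 xi2 = 0" "pinner e1 e4 = 0"
    "pinner xi1 xi1 = 0" "pinner xi1 xi2 = -1" "pinner xi1 e4 = 0"
    "pinner xi2 xi2 = 0" "pinner xi2 e4 = 0" "pinner e4 e4 = -1"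
    by (simp_all add: pinner_def xi1_def xi2_def axis_def field_simps)
  have basis': "pinner xi1 e1 = 0" "pinner xi2 e1 = 0" "pinner e4 e1 = 0"
    "pinner xi2 xi1 = -1" "pinner e4 xi1 = 0" "pinner e4 xi2 = 0"
    by (simp_all only: basis pinner_commute[of xi1 e1] pinner_commute[of xi2 e1]
        pinner_commute[of e4 e1] pinner_commute[of xi2 xi1] pinner_commute[of e4 xi1]
        pinner_commute[of e4 xi2])
  show ?thesis
    unfolding xi_vec_def pinner_simps basis basis' by (simp add: algebra_simps)
qed

lemma xi_vec_arith:
  "xi_vec a b c d + xi_vec a' b' c' d' = xi_vec (a + a') (b + b') (c + c') (d + d')"
  "xi_vec a b c d - xi_vec a' b' c' d' = xi_vec (a - a') (b - b') (c - c') (d - d')"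
  "r *\<^sub>R xi_vec a b c d = xi_vec (r * a) (r * b) (r * c) (r * d)"
  by (simp_all add: xi_vec_def algebra_simps)

text \<open>The frame is linearly independent because the inner product is nondegenerate: pairing
  with each frame vector isolates one coefficient up to sign.\<close>

lemma xi_vec_eq_0_iff: "xi_vec a b c d = 0 \<longleftrightarrow> a = 0 \<and> b = 0 \<and> c = 0 \<and> d = 0"
proof
  assume 0: "xi_vec a b c d = 0"
  have "pinner (xi_vec a b c d) w = 0" for w
    unfolding 0 by (simp add: pinner_def)
  from this[of "xi_vec _ _ _ _", unfolded pinner_xi_vec]
  have *: "a * a' - b * c' - c * b' - d * d' = 0" for a' b' c' d' by blast
  show "a = 0 \<and> b = 0 \<and> c = 0 \<and> d = 0"
    using *[of 1 0 0 0] *[of 0 1 0 0] *[of 0 0 1 0] *[of 0 0 0 1] by simp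
qed (simp add: xi_vec_def)

lemma xi_vec_eq_iff: "xi_vec a b c d = xi_vec a' b' c' d' \<longleftrightarrow> a = a' \<and> b = b' \<and> c = c' \<and> d = d'"
  using xi_vec_eq_0_iff[of "a - a'" "b - b'" "c - c'" "d - d'"] by (simp flip: xi_vec_arith(2))

lemma has_derivative_xi_vec:
  assumes "(a has_derivative a') F" "(b has_derivative b') F"
    "(c has_derivative c') F" "(d has_derivative d') F"
  shows "((\<lambda>x. xi_vec (a x) (b x) (c x) (d x)) has_derivative
    (\<lambda>h. xi_vec (a' h) (b' h) (c' h) (d' h))) F"
  unfolding xi_vec_def
  by (intro has_derivative_add has_derivative_scaleR_left assms)

lemma smooth_on_xi_vec:
  assumes "open S" "smooth_on S a" "smooth_on S b" "smooth_on S c" "smooth_on S d"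
  shows "smooth_on S (\<lambda>x. xi_vec (a x) (b x) (c x) (d x))"
  unfolding xi_vec_def
  by (intro smooth_on_add assms(1) smooth_on_linear_compose[OF assms(1) assms(2)]
      smooth_on_linear_compose[OF assms(1) assms(3)] smooth_on_linear_compose[OF assms(1) assms(4)]
      smooth_on_linear_compose[OF assms(1) assms(5)] bounded_linear_scaleR_left)

lemma profile_curve_xi_vec: "profile_curve x1 f g u = xi_vec (x1 u) (f u) (g u) 0"
  by (simp add: profile_curve_def xi_vec_def)

lemma parabolic_rotational_surface_xi_vec:
  "parabolic_rotational_surface x1 f g =
    (\<lambda>p. xi_vec (x1 (fst p)) (f (fst p)) (- (snd p)\<^sup>2 * f (fst p) + g (fst p))
      (sqrt 2 * snd p * f (fst p)))"
  by (auto simp: parabolic_rotational_surface_def xi_vec_def)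

section \<open>Derivatives and smoothness of the profile curve and the surface\<close>

lemma DERIV_compose_fst:
  fixes f :: "real \<Rightarrow> real" and p :: "real \<times> real"
  assumes "(f has_real_derivative a) (at (fst p))"
  shows "((\<lambda>q. f (fst q)) has_derivative (\<lambda>h. a * fst h)) (at p)"
  by (rule has_derivative_compose[OF has_derivative_fst[OF has_derivative_ident]
        assms[unfolded has_field_derivative_def]])

lemma vector_derivative_profile_curve:
  assumes "(x1 has_real_derivative a) (at u)" "(f has_real_derivative b) (at u)"
    "(g has_real_derivative c) (at u)"
  shows "vector_derivative (profile_curve x1 f g) (at u) = xi_vec a b c 0"
proof (rule vector_derivative_at)
  have "((\<lambda>u. xi_vec (x1 u) (f u) (g u) 0) has_derivative (\<lambda>h. xi_vec (a * h) (b * h) (c * h) 0))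
      (at u)"
    using assms by (intro has_derivative_xi_vec has_derivative_const)
      (simp_all add: has_field_derivative_def)
  then show "(profile_curve x1 f g has_vector_derivative xi_vec a b c 0) (at u)"
    by (simp add: has_vector_derivative_def profile_curve_xi_vec[abs_def] xi_vec_arith
        mult.commute)
qed

text \<open>The two \<open>xi_vec\<close> terms are \<open>z_u\<close> and \<open>z_v\<close>. Since
  \<open>z_u\<close> has the shape of the surface with \<open>x1\<close>, \<open>f\<close>,
  \<open>g\<close> replaced by their derivatives, the same rule also differentiates
  \<open>z_u\<close>.\<close>

lemma has_derivative_parabolic_rotational_surface:
  assumes "(x1 has_real_derivative a) (at (fst p))" "(f has_real_derivative b) (at (fst p))"
    "(g has_real_derivative c) (at (fst p))"
  shows "(parabolic_rotational_surface x1 f g has_derivative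
    (\<lambda>h. fst h *\<^sub>R xi_vec a b (- (snd p)\<^sup>2 * b + c) (sqrt 2 * snd p * b)
       + snd h *\<^sub>R xi_vec 0 0 (- 2 * snd p * f (fst p)) (sqrt 2 * f (fst p)))) (at p)"
proof -
  have "((\<lambda>q. - (snd q)\<^sup>2 * f (fst q) + g (fst q)) has_derivative
      (\<lambda>h. fst h * (- (snd p)\<^sup>2 * b + c) + snd h * (- 2 * snd p * f (fst p)))) (at p)"
    by (rule derivative_eq_intros DERIV_compose_fst assms has_derivative_ident refl)+
      (auto simp: algebra_simps)
  moreover have "((\<lambda>q. sqrt 2 * snd q * f (fst q)) has_derivative
      (\<lambda>h. fst h * (sqrt 2 * snd p * b) + snd h * (sqrt 2 * f (fst p)))) (at p)"
    by (rule derivative_eq_intros DERIV_compose_fst assms has_derivative_ident refl)+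
      (auto simp: algebra_simps)
  ultimately have "(parabolic_rotational_surface x1 f g has_derivative
    (\<lambda>h. xi_vec (a * fst h) (b * fst h)
       (fst h * (- (snd p)\<^sup>2 * b + c) + snd h * (- 2 * snd p * f (fst p)))
       (fst h * (sqrt 2 * snd p * b) + snd h * (sqrt 2 * f (fst p))))) (at p)"
    unfolding parabolic_rotational_surface_xi_vec
    by (intro has_derivative_xi_vec DERIV_compose_fst assms)
  then show ?thesis
    by (simp add: xi_vec_arith mult.commute)
qed

lemma smooth_on_profile_curve:
  assumes "open I" "smooth_on I x1" "smooth_on I f" "smooth_on I g"
  shows "smooth_on I (profile_curve x1 f g)"
  unfolding profile_curve_xi_vec[abs_def]
  by (intro smooth_on_xi_vec smooth_on_const assms)

text \<open>Each coefficient is a bounded linear function of the curve. As \<open>xi1\<close> and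
  \<open>xi2\<close> are null with product -1, \<open>f\<close> is read off by pairing with
  \<open>- xi2\<close> and \<open>g\<close> by pairing with \<open>- xi1\<close>.\<close>

lemma smooth_on_profile_curveD:
  assumes "open I" "smooth_on I (profile_curve x1 f g)"
  shows "smooth_on I x1" "smooth_on I f" "smooth_on I g"
proof -
  have smooth: "smooth_on I (\<lambda>u. pinner (profile_curve x1 f g u) w)" for w
  proof (rule smooth_on_linear_compose[OF assms])
    show "bounded_linear (\<lambda>x. pinner x w)"
      unfolding pinner_def by (intro bounded_linear_intros bounded_linear_vec_nth)
  qed
  show "smooth_on I x1"
    using smooth[of "xi_vec 1 0 0 0"] by (simp add: profile_curve_xi_vec pinner_xi_vec)
  show "smooth_on I f"
    using smooth[of "xi_vec 0 0 (- 1) 0"] by (simp add: profile_curve_xi_vec pinner_xi_vec)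
  show "smooth_on I g"
    using smooth[of "xi_vec 0 (- 1) 0 0"] by (simp add: profile_curve_xi_vec pinner_xi_vec)
qed

lemma smooth_on_parabolic_rotational_surface:
  assumes "open I" "smooth_on I x1" "smooth_on I f" "smooth_on I g"
  shows "smooth_on (I \<times> UNIV) (parabolic_rotational_surface x1 f g)"
proof -
  have o: "open (I \<times> (UNIV :: real set))" using assms(1) by (intro open_Times) auto
  have *: "smooth_on (I \<times> (UNIV :: real set)) (\<lambda>p. h (fst p))"
    if "smooth_on I h" for h :: "real \<Rightarrow> real"
    by (rule smooth_on_compose_linear[OF o that bounded_linear_fst]) auto
  show ?thesis
    unfolding parabolic_rotational_surface_xi_vec
    by (intro smooth_on_xi_vec smooth_on_add smooth_on_mult smooth_on_minus smooth_on_power2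
        smooth_on_const smooth_on_bounded_linear bounded_linear_snd * o assms)
qed

section \<open>Orthonormal frame and mean curvature vector\<close>

text \<open>Velocity and acceleration of a unit speed curve are orthogonal: the speed is constant on
  an open set, so its derivative vanishes.\<close>

lemma unit_speed_derivative:
  fixes x1' f' g' :: "real \<Rightarrow> real"
  assumes I: "open I" "u \<in> I"
    and d2: "(x1' has_real_derivative a) (at u)" "(f' has_real_derivative b) (at u)"
      "(g' has_real_derivative c) (at u)"
    and unit: "\<And>t. t \<in> I \<Longrightarrow> (x1' t)\<^sup>2 - 2 * f' t * g' t = 1"
  shows "x1' u * a = b * g' u + f' u * c"
proof -
  have "((\<lambda>t. (x1' t)\<^sup>2 - 2 * f' t * g' t) has_real_derivative
      2 * x1' u * a - 2 * (b * g' u + f' u * c)) (at u)"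
    by (rule derivative_eq_intros d2 refl)+ (simp add: algebra_simps)
  moreover have "((\<lambda>t. (x1' t)\<^sup>2 - 2 * f' t * g' t) has_real_derivative 0) (at u)"
    by (rule has_field_derivative_transform_within_open[OF DERIV_const I, of 1]) (simp add: unit)
  ultimately have "2 * x1' u * a - 2 * (b * g' u + f' u * c) = 0"
    by (rule DERIV_unique)
  then show ?thesis by simp
qed

lemma
  fixes x1 f g x1' f' g' :: "real \<Rightarrow> real"
  assumes I: "open I" "u \<in> I"
    and d1: "\<And>t. t \<in> I \<Longrightarrow> (x1 has_real_derivative x1' t) (at t)"
      "\<And>t. t \<in> I \<Longrightarrow> (f has_real_derivative f' t) (at t)"
      "\<And>t. t \<in> I \<Longrightarrow> (g has_real_derivative g' t) (at t)"
    and d2: "(x1' has_real_derivative a) (at u)" "(f' has_real_derivative b) (at u)"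
      "(g' has_real_derivative c) (at u)"
    and f: "f u \<noteq> 0" and unit: "\<And>t. t \<in> I \<Longrightarrow> (x1' t)\<^sup>2 - 2 * f' t * g' t = 1"
  shows orthonormal_frame_parabolic_rotational_surface:
      "orthonormal_frame_at (parabolic_rotational_surface x1 f g) coord_u
        (\<lambda>_. (0, 1 / (sqrt 2 * f u))) (u, v)"
    and mean_curvature_parabolic_rotational_surface:
      "mean_curvature (parabolic_rotational_surface x1 f g) (u, v) =
        (1 / 2) *\<^sub>R xi_vec (a + f' u / f u * x1' u) (b + f' u / f u * f' u)
          (- v\<^sup>2 * (b + f' u / f u * f' u) + c + 1 / f u + f' u / f u * g' u)
          (sqrt 2 * v * (b + f' u / f u * f' u))"
proof -
  define z where "z = parabolic_rotational_surface x1 f g"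
  define A where "A = xi_vec (x1' u) (f' u) (- v\<^sup>2 * f' u + g' u) (sqrt 2 * v * f' u)"
  define B where "B = xi_vec 0 0 (- sqrt 2 * v) 1" \<comment> \<open>the unit timelike vector along \<open>z\<^sub>v\<close>\<close>
  define N where "N = normal_part z (u, v)"
  \<comment> \<open>This is needed at all points over \<open>I\<close>, not only at
    \<open>(u, v)\<close>, because the fields \<open>push z coord_u\<close> and
    \<open>push z coord_v\<close> get differentiated below.\<close>
  have frechet: "frechet_derivative z (at p) =
    (\<lambda>h. fst h *\<^sub>R parabolic_rotational_surface x1' f' g' p
       + snd h *\<^sub>R xi_vec 0 0 (- 2 * snd p * f (fst p)) (sqrt 2 * f (fst p)))"
    if "fst p \<in> I" for p
    unfolding z_def
    by (subst frechet_derivative_at[OF has_derivative_parabolic_rotational_surface, symmetric])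
      (use that d1 in \<open>auto simp: parabolic_rotational_surface_xi_vec\<close>)
  have push_u: "push z coord_u p = parabolic_rotational_surface x1' f' g' p"
    and push_v: "push z coord_v p = xi_vec 0 0 (- 2 * snd p * f (fst p)) (sqrt 2 * f (fst p))"
    if "fst p \<in> I" for p
    using frechet[OF that] by (simp_all add: push_def)
  have A: "push z coord_u (u, v) = A"
    using I by (simp add: push_u A_def parabolic_rotational_surface_xi_vec)
  have B: "push z coord_v (u, v) = (sqrt 2 * f u) *\<^sub>R B"
    using I by (simp add: push_v B_def xi_vec_arith xi_vec_eq_iff)
  have AA: "pinner A A = 1"
    using unit[OF I(2)] by (simp add: A_def pinner_xi_vec power2_eq_square algebra_simps)
  have BB: "pinner B B = -1" by (simp add: B_def pinner_xi_vec)
  have AB: "pinner A B = 0" by (simp add: A_def B_def pinner_xi_vec)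
  have frechet_uv: "frechet_derivative z (at (u, v)) h = fst h *\<^sub>R A + (snd h * (sqrt 2 * f u)) *\<^sub>R B"
    for h
    using frechet[of "(u, v)"] I A B push_u[of "(u, v)"] push_v[of "(u, v)"] by simp
  show "orthonormal_frame_at (parabolic_rotational_surface x1 f g) coord_u
        (\<lambda>_. (0, 1 / (sqrt 2 * f u))) (u, v)"
    using f AA AB BB
    by (simp add: orthonormal_frame_at_def induced_metric_def push_def z_def[symmetric]
        frechet_uv)
  have "t \<in> tangent_space z (u, v) \<longleftrightarrow> (\<exists>r s. t = r *\<^sub>R A + s *\<^sub>R B)" for t
  proof
    assume "\<exists>r s. t = r *\<^sub>R A + s *\<^sub>R B"
    then obtain r s where "t = r *\<^sub>R A + s *\<^sub>R B" by blast
    then have "t = frechet_derivative z (at (u, v)) (r, s / (sqrt 2 * f u))"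
      using f by (simp add: frechet_uv)
    then show "t \<in> tangent_space z (u, v)" by (simp add: tangent_space_def)
  qed (auto simp: tangent_space_def frechet_uv)
  then have N: "N w = w - pinner w A *\<^sub>R A + pinner w B *\<^sub>R B" for w
    unfolding N_def by (rule normal_part_eq[OF _ AA BB AB])
  have o: "open (I \<times> (UNIV :: real set))" and uv: "(u, v) \<in> I \<times> (UNIV :: real set)"
    using I by (auto intro: open_Times)
  have "(parabolic_rotational_surface x1' f' g' has_derivative
    (\<lambda>h. fst h *\<^sub>R xi_vec a b (- v\<^sup>2 * b + c) (sqrt 2 * v * b)
       + snd h *\<^sub>R xi_vec 0 0 (- 2 * v * f' u) (sqrt 2 * f' u))) (at (u, v))"
    using has_derivative_parabolic_rotational_surface[of x1' a "(u, v)" f' b g' c] d2 by simp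
  then have "(push z coord_u has_derivative
    (\<lambda>h. fst h *\<^sub>R xi_vec a b (- v\<^sup>2 * b + c) (sqrt 2 * v * b)
       + snd h *\<^sub>R xi_vec 0 0 (- 2 * v * f' u) (sqrt 2 * f' u))) (at (u, v))"
    by (rule has_derivative_transform_within_open[OF _ o uv]) (auto simp: push_u)
  then have uu: "flat_connection z coord_u coord_u (u, v)
      = xi_vec a b (- v\<^sup>2 * b + c) (sqrt 2 * v * b)"
    by (simp add: flat_connection_def frechet_derivative_at[symmetric])
  have "((\<lambda>p. - 2 * snd p * f (fst p)) has_derivative
      (\<lambda>h. - 2 * v * (f' u * fst h) + - 2 * snd h * f u)) (at (u, v))"
    by (rule derivative_eq_intros DERIV_compose_fst d1(2) has_derivative_ident refl)+
      (use I in auto)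
  moreover have "((\<lambda>p. sqrt 2 * f (fst p)) has_derivative (\<lambda>h. sqrt 2 * (f' u * fst h)))
      (at (u, v))"
    by (rule has_derivative_mult_right DERIV_compose_fst)+ (use d1(2) I in auto)
  ultimately have "((\<lambda>p. xi_vec 0 0 (- 2 * snd p * f (fst p)) (sqrt 2 * f (fst p))) has_derivative
    (\<lambda>h. xi_vec 0 0 (- 2 * v * (f' u * fst h) + - 2 * snd h * f u) (sqrt 2 * (f' u * fst h))))
      (at (u, v))"
    by (intro has_derivative_xi_vec has_derivative_const)
  then have "(push z coord_v has_derivative
    (\<lambda>h. xi_vec 0 0 (- 2 * v * (f' u * fst h) + - 2 * snd h * f u) (sqrt 2 * (f' u * fst h))))
      (at (u, v))"
    by (rule has_derivative_transform_within_open[OF _ o uv]) (auto simp: push_v)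
  then have vv: "flat_connection z coord_v coord_v (u, v) = xi_vec 0 0 (- 2 * f u) 0"
    by (simp add: flat_connection_def frechet_derivative_at[symmetric])
  have metric: "induced_metric z coord_u coord_u (u, v) = 1"
    "induced_metric z coord_u coord_v (u, v) = 0"
    "induced_metric z coord_v coord_v (u, v) = - 2 * (f u)\<^sup>2"
    using AA AB BB by (simp_all add: induced_metric_def A B pinner_simps power2_eq_square)
  \<comment> \<open>\<open>z_uu\<close> is already normal. Against \<open>A\<close> the terms with
    \<open>v\<close> cancel and the rest is the derivative of the unit speed condition; against
    \<open>B\<close> everything cancels.\<close>
  have uuA: "pinner (xi_vec a b (- v\<^sup>2 * b + c) (sqrt 2 * v * b)) A = 0"
    using unit_speed_derivative[OF I d2 unit]
    by (simp add: A_def pinner_xi_vec algebra_simps power2_eq_square)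
  have uuB: "pinner (xi_vec a b (- v\<^sup>2 * b + c) (sqrt 2 * v * b)) B = 0"
    by (simp add: B_def pinner_xi_vec)
  have vvA: "pinner (xi_vec 0 0 (- 2 * f u) 0) A = 2 * f u * f' u"
    and vvB: "pinner (xi_vec 0 0 (- 2 * f u) 0) B = 0"
    by (simp_all add: A_def B_def pinner_xi_vec)
  have uu': "second_fundamental_form z coord_u coord_u (u, v)
      = xi_vec a b (- v\<^sup>2 * b + c) (sqrt 2 * v * b)"
    unfolding second_fundamental_form_def uu N_def[symmetric] N uuA uuB by simp
  have vv': "second_fundamental_form z coord_v coord_v (u, v)
      = xi_vec 0 0 (- 2 * f u) 0 - (2 * f u * f' u) *\<^sub>R A"
    unfolding second_fundamental_form_def vv N_def[symmetric] N vvA vvB by simp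
  \<comment> \<open>The Gram matrix is diagonal with entries 1 and \<open>- 2 * (f u)^2\<close>, so
    the mixed terms drop out and the inverse has entries 1 and
    \<open>- 1 / (2 * (f u)^2)\<close>.\<close>
  have "mean_curvature z (u, v) = (1 / 2) *\<^sub>R (xi_vec a b (- v\<^sup>2 * b + c) (sqrt 2 * v * b)
      + (- (1 / (2 * (f u)\<^sup>2))) *\<^sub>R (xi_vec 0 0 (- 2 * f u) 0 - (2 * f u * f' u) *\<^sub>R A))"
    unfolding mean_curvature_def Let_def metric uu' vv' using f by simp
  also have "\<dots> = (1 / 2) *\<^sub>R xi_vec (a + f' u / f u * x1' u) (b + f' u / f u * f' u)
          (- v\<^sup>2 * (b + f' u / f u * f' u) + c + 1 / f u + f' u / f u * g' u)
          (sqrt 2 * v * (b + f' u / f u * f' u))"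
    unfolding A_def xi_vec_arith xi_vec_eq_iff
    using f by (simp add: field_simps power2_eq_square)
  finally show "mean_curvature (parabolic_rotational_surface x1 f g) (u, v) =
        (1 / 2) *\<^sub>R xi_vec (a + f' u / f u * x1' u) (b + f' u / f u * f' u)
          (- v\<^sup>2 * (b + f' u / f u * f' u) + c + 1 / f u + f' u / f u * g' u)
          (sqrt 2 * v * (b + f' u / f u * f' u))"
    by (simp only: z_def)
qed


section \<open>When the mean curvature vector is lightlike\<close>

text \<open>Here \<open>p\<close>, \<open>q\<close>, \<open>r\<close>, \<open>s\<close> stand for
  \<open>f\<close>, \<open>f'\<close>, \<open>x1'\<close>, \<open>g'\<close>, and \<open>a\<close>,
  \<open>b\<close>, \<open>c\<close> for the second derivatives of \<open>x1\<close>,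
  \<open>f\<close>, \<open>g\<close>. The terms with \<open>v\<close> cancel; the unit speed
  condition and its derivative then eliminate \<open>s\<close> and \<open>c\<close>.\<close>

lemma pinner_mean_curvature_vector:
  fixes a b c p q r s v :: real
  assumes "p \<noteq> 0" "q \<noteq> 0" "r\<^sup>2 - 2 * q * s = 1" "r * a = b * s + q * c"
  defines "w \<equiv> xi_vec (a + q / p * r) (b + q / p * q)
          (- v\<^sup>2 * (b + q / p * q) + c + 1 / p + q / p * s) (sqrt 2 * v * (b + q / p * q))"
  shows "pinner w w = (a - b / q * r)\<^sup>2 - (b / q + q / p)\<^sup>2"
proof -
  have s: "s = (r\<^sup>2 - 1) / (2 * q)" and c: "c = (r * a - b * s) / q"
    using assms by (simp_all add: field_simps)
  have "pinner w w = (a + q / p * r)\<^sup>2 - 2 * (b + q / p * q) * (c + 1 / p + q / p * s)"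
    unfolding w_def pinner_xi_vec by (simp add: algebra_simps add_divide_distrib power2_eq_square)
  also have "\<dots> = (a - b / q * r)\<^sup>2 - (b / q + q / p)\<^sup>2"
    unfolding c s using assms(1,2) by (simp add: field_simps power2_eq_square)
  finally show ?thesis .
qed

text \<open>By \<open>b\<close>, the right side of \<open>null\<close> is 0, which determines
  \<open>a\<close> and makes the \<open>e1\<close> coefficient vanish. The \<open>xi1\<close> and
  \<open>e4\<close> coefficients vanish by \<open>b\<close> alone, leaving the one of
  \<open>xi2\<close>.\<close>

lemma mean_curvature_vector_eq_0:
  fixes a b c p q r s v :: real
  assumes "p \<noteq> 0" "q \<noteq> 0" "r\<^sup>2 - 2 * q * s = 1" "r * a = b * s + q * c"
    and b: "p * b + q\<^sup>2 = 0" and null: "(a - b / q * r)\<^sup>2 = (b / q + q / p)\<^sup>2"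
  shows "xi_vec (a + q / p * r) (b + q / p * q)
          (- v\<^sup>2 * (b + q / p * q) + c + 1 / p + q / p * s) (sqrt 2 * v * (b + q / p * q)) = 0"
proof -
  have b': "b = - (q\<^sup>2 / p)" using b assms(1) by (simp add: field_simps)
  then have bq: "b / q = - (q / p)" using assms(2) by (simp add: power2_eq_square)
  then have a: "a = - (q / p * r)" using null by simp
  \<comment> \<open>Multiplying by \<open>q\<close> allows \<open>c\<close> to be replaced through
    the derivative of the unit speed condition; what remains is a multiple of that
    condition.\<close>
  have "q * (c + 1 / p + q / p * s) = 0"
  proof -
    have "q * c = r * a - b * s" using assms by simp
    then have "q * (c + 1 / p + q / p * s) = q / p * (1 - r\<^sup>2 + 2 * q * s)"
      unfolding a b' using assms(1) by (simp add: field_simps power2_eq_square)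
    then show ?thesis using assms(3) by simp
  qed
  then show ?thesis
    using a b' assms(2) by (simp add: xi_vec_eq_0_iff power2_eq_square)
qed

text \<open>The equality of squares says that \<open>w\<close>, twice the mean curvature vector, is
  null. The first condition decides whether it is nonzero: the \<open>xi1\<close> coefficient of
  \<open>w\<close> is \<open>(f u * b + (f' u)^2) / f u\<close>.\<close>

lemma lightlike_mean_curvature_iff:
  fixes x1 f g x1' f' g' :: "real \<Rightarrow> real"
  assumes I: "open I" "u \<in> I"
    and d1: "\<And>t. t \<in> I \<Longrightarrow> (x1 has_real_derivative x1' t) (at t)"
      "\<And>t. t \<in> I \<Longrightarrow> (f has_real_derivative f' t) (at t)"
      "\<And>t. t \<in> I \<Longrightarrow> (g has_real_derivative g' t) (at t)"
    and d2: "(x1' has_real_derivative a) (at u)" "(f' has_real_derivative b) (at u)"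
      "(g' has_real_derivative c) (at u)"
    and f: "f u \<noteq> 0" "f' u \<noteq> 0"
    and unit: "\<And>t. t \<in> I \<Longrightarrow> (x1' t)\<^sup>2 - 2 * f' t * g' t = 1"
  shows "lightlike (mean_curvature (parabolic_rotational_surface x1 f g) (u, v)) \<longleftrightarrow>
    f u * b + (f' u)\<^sup>2 \<noteq> 0 \<and> (a - b / f' u * x1' u)\<^sup>2 = (b / f' u + f' u / f u)\<^sup>2"
proof -
  define w where "w = xi_vec (a + f' u / f u * x1' u) (b + f' u / f u * f' u)
          (- v\<^sup>2 * (b + f' u / f u * f' u) + c + 1 / f u + f' u / f u * g' u)
          (sqrt 2 * v * (b + f' u / f u * f' u))"
  note deriv = unit_speed_derivative[OF I d2 unit]
  have H: "mean_curvature (parabolic_rotational_surface x1 f g) (u, v) = (1 / 2) *\<^sub>R w"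
    unfolding w_def by (rule mean_curvature_parabolic_rotational_surface[OF I d1 d2 f(1) unit])
  have "pinner w w = (a - b / f' u * x1' u)\<^sup>2 - (b / f' u + f' u / f u)\<^sup>2"
    unfolding w_def by (rule pinner_mean_curvature_vector[OF f unit[OF I(2)] deriv])
  moreover have "w \<noteq> 0" if "f u * b + (f' u)\<^sup>2 \<noteq> 0"
    using that f by (auto simp: w_def xi_vec_eq_0_iff field_simps power2_eq_square)
  moreover have "w = 0" if "f u * b + (f' u)\<^sup>2 = 0"
    "(a - b / f' u * x1' u)\<^sup>2 = (b / f' u + f' u / f u)\<^sup>2"
    unfolding w_def by (rule mean_curvature_vector_eq_0[OF f unit[OF I(2)] deriv that])
  ultimately show ?thesis
    unfolding H lightlike_def pinner_simps by auto
qed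

section \<open>The formula for \<open>phi\<close> and the two directions of the theorem\<close>

lemma smooth_on_phi:
  assumes "open I" "smooth_on I f" "smooth_on I F" "\<And>u. u \<in> I \<Longrightarrow> deriv f u \<noteq> 0"
  shows "smooth_on I (phi f \<eta> C F)"
  unfolding phi_def[abs_def]
  by (intro smooth_on_mult smooth_on_add smooth_on_divide smooth_on_const
      smooth_on_deriv[OF assms(1,2)] assms)

text \<open>\<open>phi\<close> solves the linear equation
  \<open>y' = (f'' / f') y + \<eta> (f'' / f' + f' / f)\<close>, and \<open>C\<close> is its
  constant of integration, since \<open>f'\<close> solves the homogeneous equation.\<close>

lemma DERIV_phi:
  assumes "(deriv f has_real_derivative b) (at u)" "(F has_real_derivative 1 / f u) (at u)"
    and "deriv f u \<noteq> 0"
  shows "(phi f \<eta> C F has_real_derivative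
    b / deriv f u * phi f \<eta> C F u + \<eta> * (b / deriv f u + deriv f u / f u)) (at u)"
proof -
  have "((\<lambda>u. C + \<eta> * (- 1 / deriv f u + F u)) has_real_derivative
      \<eta> * (b / (deriv f u)\<^sup>2 + 1 / f u)) (at u)"
    by (rule derivative_eq_intros assms refl)+ (use assms(3) in \<open>simp add: power2_eq_square\<close>)
  from DERIV_mult[OF assms(1) this] show ?thesis
    unfolding phi_def[abs_def]
    by (rule DERIV_cong) (use assms(3) in \<open>simp add: algebra_simps power2_eq_square\<close>)
qed

text \<open>The choice of \<open>g\<close> is the unit speed condition solved for \<open>g'\<close>.
  By \<open>DERIV_phi\<close> the two squares in \<open>lightlike_mean_curvature_iff\<close> are
  those of \<open>\<eta>\<close> times a number and of that number, hence equal.\<close>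

lemma quasi_minimal_of_phi:
  assumes "open_interval I" "smooth_on I f"
    and nz: "\<And>u. u \<in> I \<Longrightarrow> f u \<noteq> 0" "\<And>u. u \<in> I \<Longrightarrow> deriv f u \<noteq> 0"
      "\<And>u. u \<in> I \<Longrightarrow> f u * deriv (deriv f) u + (deriv f u)\<^sup>2 \<noteq> 0"
    and \<eta>: "\<eta> \<in> {1, -1}"
    and F: "antiderivative_on I F (\<lambda>u. 1 / f u)"
    and x1: "antiderivative_on I x1 (phi f \<eta> C F)"
    and g: "antiderivative_on I g (\<lambda>u. ((phi f \<eta> C F u)\<^sup>2 - 1) / (2 * deriv f u))"
  shows "spacelike_curve (profile_curve x1 f g) I"
    and "arc_length_param (profile_curve x1 f g) I"
    and "quasi_minimal (parabolic_rotational_surface x1 f g) (I \<times> UNIV)"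
proof -
  define \<phi> where "\<phi> = phi f \<eta> C F"
  define g' where "g' = (\<lambda>u. ((\<phi> u)\<^sup>2 - 1) / (2 * deriv f u))"
  have I: "open I" using assms(1) by (simp add: open_interval_def)
  have smooth_f': "smooth_on I (deriv f)" by (rule smooth_on_deriv[OF I assms(2)])
  have smooth_F: "smooth_on I F"
    by (rule smooth_on_antiderivative[OF I smooth_on_divide[OF I smooth_on_const assms(2) nz(1)] F])
  have smooth_\<phi>: "smooth_on I \<phi>"
    unfolding \<phi>_def by (rule smooth_on_phi[OF I assms(2) smooth_F nz(2)])
  have smooth_g': "smooth_on I g'"
    unfolding g'_def
    by (intro smooth_on_divide smooth_on_diff smooth_on_power2 smooth_on_mult smooth_on_const
        I smooth_\<phi> smooth_f') (use nz(2) in simp)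
  have smooth_x1: "smooth_on I x1"
    by (rule smooth_on_antiderivative[OF I smooth_\<phi> x1[folded \<phi>_def]])
  have smooth_g: "smooth_on I g"
    by (rule smooth_on_antiderivative[OF I smooth_g' g[folded \<phi>_def, folded g'_def]])
  have d1: "(x1 has_real_derivative \<phi> u) (at u)" "(f has_real_derivative deriv f u) (at u)"
    "(g has_real_derivative g' u) (at u)" if "u \<in> I" for u
    using that x1 g smooth_on_DERIV[OF assms(2) that]
    by (simp_all add: antiderivative_on_def \<phi>_def g'_def)
  have unit: "(\<phi> u)\<^sup>2 - 2 * deriv f u * g' u = 1" if "u \<in> I" for u
    using nz(2)[OF that] by (simp add: g'_def)
  have speed: "pinner (vector_derivative (profile_curve x1 f g) (at u))
      (vector_derivative (profile_curve x1 f g) (at u)) = 1" if "u \<in> I" for u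
    using unit[OF that]
    by (simp add: vector_derivative_profile_curve[OF d1[OF that]] pinner_xi_vec power2_eq_square
        algebra_simps)
  show "spacelike_curve (profile_curve x1 f g) I"
    using smooth_on_profile_curve[OF I smooth_x1 assms(2) smooth_g] speed
    by (simp add: spacelike_curve_def spacelike_def)
  show "arc_length_param (profile_curve x1 f g) I"
    using speed by (simp add: arc_length_param_def)
  have d2: "(\<phi> has_real_derivative
      deriv (deriv f) u / deriv f u * \<phi> u + \<eta> * (deriv (deriv f) u / deriv f u + deriv f u / f u))
      (at u)"
    "(deriv f has_real_derivative deriv (deriv f) u) (at u)"
    "(g' has_real_derivative deriv g' u) (at u)" if "u \<in> I" for u
    using DERIV_phi[OF smooth_on_DERIV[OF smooth_f' that] _ nz(2)[OF that]] F that
      smooth_on_DERIV[OF smooth_f' that] smooth_on_DERIV[OF smooth_g' that]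
    by (simp_all add: antiderivative_on_def \<phi>_def)
  have "lorentz_surface (parabolic_rotational_surface x1 f g) (I \<times> UNIV)"
    unfolding lorentz_surface_def
    using smooth_on_parabolic_rotational_surface[OF I smooth_x1 assms(2) smooth_g]
      orthonormal_frame_parabolic_rotational_surface[OF I _ d1 d2 nz(1) unit]
    by blast
  moreover have "lightlike (mean_curvature (parabolic_rotational_surface x1 f g) (u, v))"
    if "u \<in> I" for u v
    using lightlike_mean_curvature_iff[OF I that d1 d2[OF that] nz(1,2)[OF that] unit]
      nz(3)[OF that] \<eta> by (auto simp: power_mult_distrib)
  ultimately show "quasi_minimal (parabolic_rotational_surface x1 f g) (I \<times> UNIV)"
    by (auto simp: quasi_minimal_def)
qed

text \<open>The quotient of \<open>x\<^sub>1'' - f'' x\<^sub>1' / f'\<close> by \<open>f'' / f' + f' / f\<close> is continuous with values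
  \<open>\<plusminus>1\<close>, so it is a constant \<open>\<eta>\<close>, and then \<open>\<eta> x\<^sub>1' / f' + 1 / f'\<close> is an antiderivative of
  \<open>1 / f\<close>. So \<open>I = J\<close> and \<open>C = 0\<close> will do.\<close>

lemma phi_of_quasi_minimal:
  assumes "open_interval J"
    and "spacelike_curve (profile_curve x1 f g) J"
    and "arc_length_param (profile_curve x1 f g) J"
    and nz: "\<And>u. u \<in> J \<Longrightarrow> f u \<noteq> 0" "\<And>u. u \<in> J \<Longrightarrow> deriv f u \<noteq> 0"
    and qm: "quasi_minimal (parabolic_rotational_surface x1 f g) (J \<times> UNIV)"
  shows "(\<forall>u\<in>J. f u * deriv (deriv f) u + (deriv f u)\<^sup>2 \<noteq> 0) \<and>
    (\<exists>\<eta>\<in>{1, -1 :: real}. \<exists>F. antiderivative_on J F (\<lambda>u. 1 / f u) \<and>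
      (\<forall>u\<in>J. deriv x1 u = phi f \<eta> 0 F u
         \<and> deriv g u = ((phi f \<eta> 0 F u)\<^sup>2 - 1) / (2 * deriv f u)))"
proof -
  have J: "open J" "connected J" "J \<noteq> {}"
    using assms(1) by (simp_all add: open_interval_def is_interval_connected_1)
  have smooth: "smooth_on J x1" "smooth_on J f" "smooth_on J g"
    using smooth_on_profile_curveD[OF J(1), of x1 f g] assms(2)
    by (simp_all add: spacelike_curve_def)
  note smooth' = smooth[THEN smooth_on_deriv[OF J(1)]]
  note d1 = smooth[THEN smooth_on_DERIV] and d2 = smooth'[THEN smooth_on_DERIV]
  have unit: "(deriv x1 u)\<^sup>2 - 2 * deriv f u * deriv g u = 1" if "u \<in> J" for u
    using bspec[OF assms(3)[unfolded arc_length_param_def] that]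
    by (simp add: vector_derivative_profile_curve[OF d1[OF that]]
        pinner_xi_vec power2_eq_square algebra_simps)
  define \<alpha> where "\<alpha> = (\<lambda>u. deriv (deriv x1) u - deriv (deriv f) u / deriv f u * deriv x1 u)"
  define \<beta> where "\<beta> = (\<lambda>u. deriv (deriv f) u / deriv f u + deriv f u / f u)"
  \<comment> \<open>The criterion does not involve \<open>v\<close>, so the points with
    \<open>v = 0\<close> suffice.\<close>
  have null: "f u * deriv (deriv f) u + (deriv f u)\<^sup>2 \<noteq> 0" "(\<alpha> u)\<^sup>2 = (\<beta> u)\<^sup>2" if "u \<in> J" for u
    using lightlike_mean_curvature_iff[OF J(1) that d1 d2[OF that] nz[OF that] unit, of 0] qm that
    by (auto simp: quasi_minimal_def \<alpha>_def \<beta>_def)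
  \<comment> \<open>\<open>\<beta>\<close> is \<open>(f f'' + f'^2) / (f f')\<close>.\<close>
  have \<beta>: "\<beta> u \<noteq> 0" if "u \<in> J" for u
    using null(1)[OF that] nz[OF that] by (simp add: \<beta>_def field_simps power2_eq_square)
  have "isCont \<alpha> u" "isCont \<beta> u" if "u \<in> J" for u
    unfolding \<alpha>_def \<beta>_def
    using d1[OF that, THEN DERIV_isCont] d2[OF that, THEN DERIV_isCont] nz[OF that] that
      smooth'(1,2)[THEN smooth_on_deriv[OF J(1)], THEN smooth_on_DERIV, THEN DERIV_isCont]
    by (auto intro!: continuous_intros)
  then have "continuous_on J \<alpha>" "continuous_on J \<beta>"
    by (auto intro: continuous_at_imp_continuous_on)
  then have cont: "continuous_on J (\<lambda>u. \<alpha> u / \<beta> u)"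
    using \<beta> by (intro continuous_on_divide) auto
  have pm: "\<alpha> u / \<beta> u = 1 \<or> \<alpha> u / \<beta> u = - 1" if "u \<in> J" for u
    using null(2)[OF that] \<beta>[OF that] by (auto simp: power2_eq_iff)
  have "(\<lambda>u. \<alpha> u / \<beta> u) constant_on J"
  proof (rule continuous_finite_range_constant[OF J(2) cont])
    show "finite ((\<lambda>u. \<alpha> u / \<beta> u) ` J)"
      by (rule finite_subset[of _ "{1, - 1}"]) (use pm in blast, simp)
  qed
  then obtain \<eta> where \<eta>: "\<And>u. u \<in> J \<Longrightarrow> \<alpha> u / \<beta> u = \<eta>"
    unfolding constant_on_def by blast
  have \<eta>_pm: "\<eta> \<in> {1, -1}" using J(3) \<eta> pm by blast
  then have \<eta>_sq: "\<eta> * (\<eta> * x) = x" for x by auto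
  have \<alpha>: "\<alpha> u = \<eta> * \<beta> u" if "u \<in> J" for u
    using \<eta>[OF that] \<beta>[OF that] by (simp add: field_simps)
  \<comment> \<open>This is \<open>deriv x1 u = phi f \<eta> 0 F u\<close> solved for
    \<open>F u\<close>, using that \<open>\<eta>\<close> is its own inverse. The constant is
    absorbed into the choice of the antiderivative.\<close>
  define F where "F = (\<lambda>u. \<eta> * (deriv x1 u / deriv f u) + 1 / deriv f u)"
  have "(F has_real_derivative 1 / f u) (at u)" if u: "u \<in> J" for u
  proof -
    have "(F has_real_derivative \<eta> * (\<alpha> u / deriv f u) - deriv (deriv f) u / (deriv f u)\<^sup>2) (at u)"
      unfolding F_def
      by (rule derivative_eq_intros d2[OF u] refl nz(2)[OF u])+
        (use nz(2)[OF u] in \<open>simp add: \<alpha>_def field_simps power2_eq_square\<close>)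
    moreover have "\<eta> * (\<alpha> u / deriv f u) - deriv (deriv f) u / (deriv f u)\<^sup>2 = 1 / f u"
      using nz[OF u] by (simp add: \<alpha>[OF u] \<eta>_sq \<beta>_def field_simps power2_eq_square)
    ultimately show ?thesis by simp
  qed
  then have "antiderivative_on J F (\<lambda>u. 1 / f u)" by (simp add: antiderivative_on_def)
  moreover have "deriv x1 u = phi f \<eta> 0 F u" if "u \<in> J" for u
    using nz(2)[OF that] by (simp add: phi_def F_def algebra_simps \<eta>_sq)
  moreover have "deriv g u = ((deriv x1 u)\<^sup>2 - 1) / (2 * deriv f u)" if "u \<in> J" for u
    using unit[OF that] nz(2)[OF that] by (simp add: field_simps)
  ultimately show ?thesis
    using null(1) \<eta>_pm by (metis (no_types, lifting))
qed

theorem theorem3p9: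
  shows "(\<forall>(I :: real set) (f :: real \<Rightarrow> real) (\<eta> :: real) (C :: real) (F :: real \<Rightarrow> real)
            (x1 :: real \<Rightarrow> real) (g :: real \<Rightarrow> real).
        open_interval I \<and> smooth_on I f
        \<and> (\<forall>u\<in>I. f u \<noteq> 0 \<and> deriv f u \<noteq> 0 \<and> f u * deriv (deriv f) u + (deriv f u)\<^sup>2 \<noteq> 0)
        \<and> \<eta> \<in> {1, -1}
        \<and> antiderivative_on I F (\<lambda>u. 1 / f u)
        \<and> antiderivative_on I x1 (phi f \<eta> C F)
        \<and> antiderivative_on I g (\<lambda>u. ((phi f \<eta> C F u)\<^sup>2 - 1) / (2 * deriv f u))
        \<longrightarrow> spacelike_curve (profile_curve x1 f g) I
          \<and> arc_length_param (profile_curve x1 f g) I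
          \<and> quasi_minimal (parabolic_rotational_surface x1 f g) (I \<times> UNIV))
    \<and>
      (\<forall>(J :: real set) (x1 :: real \<Rightarrow> real) (f :: real \<Rightarrow> real) (g :: real \<Rightarrow> real).
        open_interval J
        \<and> spacelike_curve (profile_curve x1 f g) J
        \<and> arc_length_param (profile_curve x1 f g) J
        \<and> (\<forall>u\<in>J. f u \<noteq> 0 \<and> deriv f u \<noteq> 0)
        \<and> quasi_minimal (parabolic_rotational_surface x1 f g) (J \<times> UNIV)
        \<longrightarrow> (\<forall>u0\<in>J. \<exists>I. open_interval I \<and> u0 \<in> I \<and> I \<subseteq> J
              \<and> (\<forall>u\<in>I. f u * deriv (deriv f) u + (deriv f u)\<^sup>2 \<noteq> 0)
              \<and> (\<exists>\<eta>\<in>{1, -1 :: real}. \<exists>(C :: real) (F :: real \<Rightarrow> real).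
                    antiderivative_on I F (\<lambda>u. 1 / f u)
                  \<and> (\<forall>u\<in>I. deriv x1 u = phi f \<eta> C F u
                        \<and> deriv g u = ((phi f \<eta> C F u)\<^sup>2 - 1) / (2 * deriv f u)))))"
proof (intro conjI allI impI; elim conjE)
  fix I f \<eta> C F x1 g
  assume a: "open_interval I" "smooth_on I f"
    "\<forall>u\<in>I. f u \<noteq> 0 \<and> deriv f u \<noteq> 0 \<and> f u * deriv (deriv f) u + (deriv f u)\<^sup>2 \<noteq> 0"
    "\<eta> \<in> {1, -1 :: real}" "antiderivative_on I F (\<lambda>u. 1 / f u)"
    "antiderivative_on I x1 (phi f \<eta> C F)"
    "antiderivative_on I g (\<lambda>u. ((phi f \<eta> C F u)\<^sup>2 - 1) / (2 * deriv f u))"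
  have nz: "f u \<noteq> 0" "deriv f u \<noteq> 0" "f u * deriv (deriv f) u + (deriv f u)\<^sup>2 \<noteq> 0"
    if "u \<in> I" for u using a(3) that by auto
  note * = quasi_minimal_of_phi[OF a(1,2) nz a(4-7)]
  show "spacelike_curve (profile_curve x1 f g) I" by (rule *(1))
  show "arc_length_param (profile_curve x1 f g) I" by (rule *(2))
  show "quasi_minimal (parabolic_rotational_surface x1 f g) (I \<times> UNIV)" by (rule *(3))
next
  fix J x1 f g
  assume a: "open_interval J" "spacelike_curve (profile_curve x1 f g) J"
    "arc_length_param (profile_curve x1 f g) J" "\<forall>u\<in>J. f u \<noteq> 0 \<and> deriv f u \<noteq> 0"
    "quasi_minimal (parabolic_rotational_surface x1 f g) (J \<times> UNIV)"
  have nz: "f u \<noteq> 0" "deriv f u \<noteq> 0" if "u \<in> J" for u using a(4) that by auto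
  note * = phi_of_quasi_minimal[OF a(1-3) nz a(5)]
  show "\<forall>u0\<in>J. \<exists>I. open_interval I \<and> u0 \<in> I \<and> I \<subseteq> J
              \<and> (\<forall>u\<in>I. f u * deriv (deriv f) u + (deriv f u)\<^sup>2 \<noteq> 0)
              \<and> (\<exists>\<eta>\<in>{1, -1 :: real}. \<exists>(C :: real) (F :: real \<Rightarrow> real).
                    antiderivative_on I F (\<lambda>u. 1 / f u)
                  \<and> (\<forall>u\<in>I. deriv x1 u = phi f \<eta> C F u
                        \<and> deriv g u = ((phi f \<eta> C F u)\<^sup>2 - 1) / (2 * deriv f u)))"
  \<comment> \<open>The neighbourhood need not depend on \<open>u0\<close>:
    \<open>phi_of_quasi_minimal\<close> gives one sign and one antiderivative on all of
    \<open>J\<close>.\<close>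
  proof (intro ballI exI[of _ J] conjI a(1) subset_refl)
    show "\<exists>\<eta>\<in>{1, -1 :: real}. \<exists>(C :: real) (F :: real \<Rightarrow> real).
                    antiderivative_on J F (\<lambda>u. 1 / f u)
                  \<and> (\<forall>u\<in>J. deriv x1 u = phi f \<eta> C F u
                        \<and> deriv g u = ((phi f \<eta> C F u)\<^sup>2 - 1) / (2 * deriv f u))"
      using * by blast
  qed (use * in auto)
qed

end
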